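(* Let $C>0$ be a given constant, let $0<\varepsilon_g<1/2$, and let $0<a_1<a_2$ be constants. Let $\xi_1,\dots,\xi_n$ be i.i.d. copies of a subgaussian random variable with mean zero and variance one. Assume $a_1N\le x\le a_2N$ and $x\le\sqrt n-N^{\varepsilon_g}$. Then for $\delta=N^{-C}$ and any open ball (interval) $B(a,\delta)\subset\mathbb R$, \[\mathbb P\big(P_n(x)\in B(a,\delta)\big)=O(\delta),\] where $P_n(x)=e^{-x^2/2}\sum_{i=1}^n\xi_i x^i/\sqrt{i!}$.
   Context: $N$ is a large parameter with $N\le\sqrt n$ (in the paper $N=M$, the scale of the interval $[c_1M,c_2M]\subset[0,\sqrt n-M]$); implied constants may depend on $C,\varepsilon_g,a_1,a_2$ and the law of $\xi$. Equivalently $P_n(x)=\frac1{\sqrt N}\sum_{i=1}^n\xi_ib_i(x)$ with $b_i(x)=\sqrt N e^{-x^2/2}x^i/\sqrt{i!}$. *)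

theory Defs
  imports "HOL-Probability.Probability"
begin

definition Pn :: "nat \<Rightarrow> (nat \<Rightarrow> real) \<Rightarrow> real \<Rightarrow> real" where
  "Pn n \<xi> x = exp (- (x ^ 2) / 2) * (\<Sum>i = 1..n. \<xi> i * x ^ i / sqrt (fact i))"

definition subgaussian :: "real measure \<Rightarrow> bool" where
  "subgaussian \<mu> \<longleftrightarrow> (\<exists>K>0. \<forall>t\<ge>0. measure \<mu> {y. \<bar>y\<bar> > t} \<le> 2 * exp (- (t ^ 2) / K ^ 2))"

end

theory Submission
  imports Defs "HOL-Real_Asymp.Real_Asymp"
begin

text \<open>By a Gaussian form of Esseen's inequality, it suffices that the characteristic function
  $\Phi(t) = \prod_i \varphi(t c_i)$ of $P_n(x)$, where $c_i = e^{-x^2/2} x^i/\sqrt{i!}$, is bounded by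
  $e^{-\beta t^2} + N^{-C}$ for $|t| \le N^{C+1}$. Since \<open>\<xi>\<close> has variance one,
  $|\varphi(s)| \le e^{-s^2/4}$ for $|s| \le s_0$, and the $c_i^2$ are the Poisson weights with mean $x^2 \le n$.
  While all $|t| c_i \le s_0$, the bulk of the Poisson mass gives $e^{-\beta t^2}$. Otherwise
  the weights left of the mode pass slowly through the scale $1/|t|$, so that of order $\sqrt x$ factors have
  $|t| c_i$ comparable to $s_0$, and $|\Phi(t)| \le e^{-\gamma \sqrt x}$.\<close>

section \<open>Characteristic functions: decay near the origin and linear combinations\<close>

text \<open>The second-order Taylor remainder is \<open>t\<^sup>2 / 6\<close> times the expectation
  \<open>?r t\<close>, which tends to 0 by dominated convergence. Once \<open>?r t < 1\<close>, the
  modulus is at most 1 - t^2/3, hence below 1 - t^2/4.\<close>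

lemma (in real_distribution) char_gaussian_decay:
  assumes "integrable M (\<lambda>x. x)" and "expectation (\<lambda>x. x) = 0"
    and "integrable M (\<lambda>x. x\<^sup>2)" and "expectation (\<lambda>x. x\<^sup>2) = 1"
  obtains s where "s > 0" and "\<And>t. \<bar>t\<bar> \<le> s \<Longrightarrow> cmod (char M t) \<le> exp (- t\<^sup>2 / 4)"
proof -
  let ?r = "\<lambda>t. expectation (\<lambda>x. min (6 * x\<^sup>2) (\<bar>t\<bar> * \<bar>x\<bar> ^ 3))"
  have "((\<lambda>t. expectation (\<lambda>x. min (6 * x\<^sup>2) (\<bar>t\<bar> * \<bar>x\<bar> ^ 3))) \<longlongrightarrow> expectation (\<lambda>x. min (6 * x\<^sup>2) (\<bar>0::real\<bar> * \<bar>x\<bar> ^ 3))) (at 0)"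
    unfolding tendsto_at_iff_sequentially comp_def
  proof safe
    fix X :: "nat \<Rightarrow> real" assume X: "X \<longlonglongrightarrow> 0"
    show "(\<lambda>n. ?r (X n)) \<longlonglongrightarrow> ?r 0"
    proof (rule integral_dominated_convergence[where w="\<lambda>x. 6 * x\<^sup>2"])
      show "AE x in M. (\<lambda>n. min (6 * x\<^sup>2) (\<bar>X n\<bar> * \<bar>x\<bar> ^ 3)) \<longlonglongrightarrow> min (6 * x\<^sup>2) (\<bar>0\<bar> * \<bar>x\<bar> ^ 3)"
        by (intro AE_I2 tendsto_min tendsto_mult tendsto_rabs tendsto_const X)
      show "AE x in M. norm (min (6 * x\<^sup>2) (\<bar>X n\<bar> * \<bar>x\<bar> ^ 3)) \<le> 6 * x\<^sup>2" for n
        by (intro AE_I2) (simp add: min.coboundedI1)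
      show "integrable M (\<lambda>x. 6 * x\<^sup>2)" using assms(3) by simp
    qed measurable
  qed
  then have "(?r \<longlongrightarrow> 0) (at 0)" by (simp add: min_absorb2)
  then have "eventually (\<lambda>t. ?r t < 1) (at 0)"
    by (rule order_tendstoD) simp
  then obtain d where d: "d > 0" "\<And>t. t \<noteq> 0 \<Longrightarrow> \<bar>t\<bar> < d \<Longrightarrow> ?r t < 1"
    by (auto simp: eventually_at dist_real_def)
  show ?thesis
  proof
    \<comment> \<open>Halving \<open>d\<close> gives the strict inequality
      \<open>\<bar>t\<bar> < d\<close>; the cap 1 keeps 1 - t^2/2 nonnegative, so that it equals its
      modulus.\<close>
    show "min (d/2) 1 > 0" using d by simp
    fix t :: real assume t: "\<bar>t\<bar> \<le> min (d/2) 1"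
    show "cmod (char M t) \<le> exp (- t\<^sup>2 / 4)"
    proof (cases "t = 0")
      case True then show ?thesis using cmod_char_le_1[of 0] by simp
    next
      case False
      have r: "?r t < 1" using d t False by auto
      have "t\<^sup>2 \<le> 1" using t by (simp add: abs_square_le_1)
      have "cmod (char M t - (1 - t\<^sup>2 * 1 / 2)) \<le> (t\<^sup>2 / 6) * ?r t"
        by (rule char_approx3) (use assms in auto)
      also have "\<dots> \<le> t\<^sup>2 / 6 * 1" using r by (intro mult_left_mono) auto
      finally have "cmod (char M t - (1 - t\<^sup>2 * 1 / 2)) \<le> t\<^sup>2 / 6" by simp
      moreover have "cmod (complex_of_real (1 - t\<^sup>2 / 2)) = 1 - t\<^sup>2 / 2"
        using \<open>t\<^sup>2 \<le> 1\<close> unfolding norm_of_real by simp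
      ultimately have "cmod (char M t) \<le> 1 - t\<^sup>2 / 2 + t\<^sup>2 / 6"
        using norm_triangle_sub[of "char M t" "complex_of_real (1 - t\<^sup>2 / 2)"] by simp
      also have "\<dots> \<le> 1 + (- t\<^sup>2 / 4)" by simp
      also have "\<dots> \<le> exp (- t\<^sup>2 / 4)" by (rule exp_ge_add_one_self)
      finally show ?thesis .
    qed
  qed
qed

text \<open>Independence enters here: the exponential of the sum splits over the coordinates, and so
  does its integral over the product measure.\<close>

lemma char_PiM_linear_combination:
  assumes "real_distribution M" and "finite I"
  shows "char (distr (PiM I (\<lambda>_. M)) borel (\<lambda>\<omega>. \<Sum>i\<in>I. c i * \<omega> i)) t = (\<Prod>i\<in>I. char M (t * c i))"
proof -
  interpret real_distribution M by fact
  interpret product_sigma_finite "\<lambda>_. M" by standard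
  have [measurable]: "(\<lambda>\<omega>. \<omega> i) \<in> borel_measurable (PiM I (\<lambda>_. M))" if "i \<in> I" for i
    using measurable_component_singleton[OF that, of "\<lambda>_. M"] by (simp cong: measurable_cong_sets)
  have "char (distr (PiM I (\<lambda>_. M)) borel (\<lambda>\<omega>. \<Sum>i\<in>I. c i * \<omega> i)) t
      = (CLINT \<omega>|PiM I (\<lambda>_. M). (\<Prod>i\<in>I. iexp (t * c i * \<omega> i)))"
    unfolding char_def
    by (subst integral_distr)
       (auto simp: sum_distrib_left exp_sum[OF assms(2)] mult.assoc intro!: borel_measurable_sum Bochner_Integration.integral_cong)
  also have "\<dots> = (\<Prod>i\<in>I. char M (t * c i))"
    unfolding char_def
    by (rule product_integral_prod[OF assms(2)]) (intro integrable_const_bound[of _ 1], auto)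
  finally show ?thesis .
qed

section \<open>Small balls and Gaussian averages of the characteristic function\<close>

text \<open>A Gaussian of width \<open>d\<close> centred at \<open>a\<close> is at least
  \<open>exp (-1/2)\<close> on the ball. It is also the standard normal characteristic function at
  \<open>(x - a) / d\<close>, so Fubini turns its expectation into an average of
  \<open>char M\<close> over normal frequencies.\<close>

lemma (in real_distribution) small_ball_char:
  assumes "d > 0"
  shows "prob (ball a d) \<le> exp (1/2) * (LINT z|std_normal_distribution. cmod (char M (z / d)))"
proof -
  interpret Z: real_distribution std_normal_distribution by (rule real_dist_normal_dist)
  interpret P: pair_prob_space M std_normal_distribution ..
  have int: "integrable (M \<Otimes>\<^sub>M std_normal_distribution) (\<lambda>(x, z). iexp ((x - a) / d * z))"
    by (rule P.integrable_const_bound[of _ 1]) (auto simp: case_prod_beta)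
  have intM: "integrable M (\<lambda>x. exp (- ((x - a) / d)\<^sup>2 / 2))"
    by (rule integrable_const_bound[of _ 1]) auto
  \<comment> \<open>The centre \<open>a\<close> contributes only a phase, so the final bound is
    uniform in \<open>a\<close>.\<close>
  have eq: "(CLINT x|M. iexp ((x - a) / d * z)) = char M (z / d) * iexp (- a * z / d)" for z
    unfolding char_def integral_mult_left_zero[symmetric]
    by (intro Bochner_Integration.integral_cong refl) (simp add: mult_exp_exp field_simps diff_divide_distrib)
  have "exp (-1/2) * prob (ball a d) = expectation (\<lambda>x. exp (-1/2) * indicator (ball a d) x)"
    by simp
  also have "\<dots> \<le> expectation (\<lambda>x. exp (- ((x - a) / d)\<^sup>2 / 2))"
  proof (intro integral_mono intM)
    fix x
    have "exp (-1/2) \<le> exp (- ((x - a) / d)\<^sup>2 / 2)" if "x \<in> ball a d"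
    proof -
      have "\<bar>(x - a) / d\<bar> \<le> 1" using that assms by (simp add: dist_real_def abs_minus_commute)
      then have "((x - a) / d)\<^sup>2 \<le> 1" by (simp only: abs_square_le_1)
      then show ?thesis by simp
    qed
    then show "exp (-1/2) * indicator (ball a d) x \<le> exp (- ((x - a) / d)\<^sup>2 / 2)"
      by (auto simp: indicator_def)
  qed (auto intro!: integrable_const_bound[of _ 1] borel_measurable_indicator)
  also have "\<dots> = cmod (CLINT x|M. complex_of_real (exp (- ((x - a) / d)\<^sup>2 / 2)))"
    by (subst integral_complex_of_real) (simp only: norm_of_real, simp)
  also have "(CLINT x|M. complex_of_real (exp (- ((x - a) / d)\<^sup>2 / 2)))
      = (CLINT x|M. CLINT z|std_normal_distribution. iexp ((x - a) / d * z))"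
    using fun_cong[OF char_std_normal_distribution] unfolding char_def by (simp only:)
  also have "\<dots> = (CLINT z|std_normal_distribution. CLINT x|M. iexp ((x - a) / d * z))"
    by (rule P.Fubini_integral[OF int, symmetric])
  also have "cmod \<dots> \<le> (LINT z|std_normal_distribution. cmod (CLINT x|M. iexp ((x - a) / d * z)))"
    by (rule integral_norm_bound)
  also have "\<dots> = (LINT z|std_normal_distribution. cmod (char M (z / d)))"
    unfolding eq by (simp add: norm_mult)
  finally have "exp (1/2) * (exp (-1/2) * prob (ball a d)) \<le> exp (1/2) * (LINT z|std_normal_distribution. cmod (char M (z / d)))"
    by (rule mult_left_mono) simp
  then show ?thesis by (simp add: mult.assoc[symmetric] mult_exp_exp)
qed

lemma gaussian_lborel:
  assumes "b > 0"
  shows "integrable lborel (\<lambda>z::real. exp (- b * z\<^sup>2))" and "(LBINT z. exp (- b * z\<^sup>2)) = sqrt (pi / b)"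
proof -
  \<comment> \<open>The standard deviation for which \<open>z\<^sup>2 / (2 * s\<^sup>2)\<close>
    equals \<open>b * z\<^sup>2\<close>.\<close>
  define s where "s = sqrt (1 / (2 * b))"
  have s: "s\<^sup>2 = 1 / (2 * b)" using assms by (simp add: s_def)
  have eq: "exp (- b * z\<^sup>2) = sqrt (pi / b) * normal_density 0 s z" for z
    using assms by (simp add: normal_density_def s field_simps)
  have "s > 0" using assms by (simp add: s_def)
  then show "integrable lborel (\<lambda>z::real. exp (- b * z\<^sup>2))" "(LBINT z. exp (- b * z\<^sup>2)) = sqrt (pi / b)"
    unfolding eq by auto
qed

text \<open>The hypothesis says nothing about $|z| \ge T$, where the normal density itself is small.\<close>
lemma std_normal_integral_le:
  fixes h :: "real \<Rightarrow> real"
  assumes [measurable]: "h \<in> borel_measurable borel" and h: "\<And>z. 0 \<le> h z" "\<And>z. h z \<le> 1"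
    and "b > 0" "\<epsilon> \<ge> 0" "T \<ge> 0" and bound: "\<And>z. \<bar>z\<bar> \<le> T \<Longrightarrow> h z \<le> exp (- b * z\<^sup>2) + \<epsilon>"
  shows "(LINT z|std_normal_distribution. h z) \<le> 1 / sqrt (2 * b) + \<epsilon> + sqrt 2 * exp (- T\<^sup>2 / 4)"
proof -
  \<comment> \<open>The first two terms dominate for \<open>\<bar>z\<bar> \<le> T\<close>. Beyond
    \<open>T\<close>, half of the exponent z^2/2 yields the factor
    \<open>exp (- T\<^sup>2 / 4)\<close>, and the other half stays integrable.\<close>
  let ?g = "\<lambda>z. 1 / sqrt (2 * pi) * exp (- b * z\<^sup>2) + \<epsilon> * std_normal_density z
      + exp (- T\<^sup>2 / 4) / sqrt (2 * pi) * exp (- (1/4) * z\<^sup>2)"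
  have pw: "std_normal_density z * h z \<le> ?g z" for z
  proof (cases "\<bar>z\<bar> \<le> T")
    case True
    have "std_normal_density z \<le> 1 / sqrt (2 * pi)"
      by (simp add: std_normal_density_def divide_right_mono)
    have "std_normal_density z * h z \<le> std_normal_density z * (exp (- b * z\<^sup>2) + \<epsilon>)"
      by (intro mult_left_mono bound True) simp
    also have "\<dots> \<le> 1 / sqrt (2 * pi) * exp (- b * z\<^sup>2) + \<epsilon> * std_normal_density z"
      using mult_right_mono[OF \<open>std_normal_density z \<le> 1 / sqrt (2 * pi)\<close>, of "exp (- b * z\<^sup>2)"]
      by (simp add: algebra_simps)
    finally show ?thesis by (smt (verit) divide_nonneg_nonneg exp_ge_zero mult_nonneg_nonneg pi_ge_zero real_sqrt_ge_zero)
  next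
    case False
    then have "T\<^sup>2 \<le> z\<^sup>2" using \<open>T \<ge> 0\<close> by (simp add: abs_le_square_iff[symmetric])
    then have "exp (- z\<^sup>2 / 2) \<le> exp (- T\<^sup>2 / 4) * exp (- (1/4) * z\<^sup>2)"
      by (simp add: mult_exp_exp)
    then have "std_normal_density z \<le> exp (- T\<^sup>2 / 4) / sqrt (2 * pi) * exp (- (1/4) * z\<^sup>2)"
      by (simp add: std_normal_density_def field_simps)
    moreover have "std_normal_density z * h z \<le> std_normal_density z * 1"
      by (intro mult_left_mono h) simp
    moreover have "0 \<le> 1 / sqrt (2 * pi) * exp (- b * z\<^sup>2) + \<epsilon> * std_normal_density z"
      using assms by simp
    ultimately show ?thesis by linarith
  qed
  have g0: "0 \<le> ?g z" for z
    using \<open>\<epsilon> \<ge> 0\<close> by (intro add_nonneg_nonneg mult_nonneg_nonneg) auto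
  have intg: "integrable lborel ?g"
    by (intro Bochner_Integration.integrable_add integrable_mult_right gaussian_lborel) (use assms in auto)
  have "(LINT z|std_normal_distribution. h z) = (LBINT z. std_normal_density z * h z)"
    by (subst integral_density) auto
  also have "\<dots> \<le> (LBINT z. ?g z)"
    by (rule integral_mono'[OF intg pw g0])
  also have "\<dots> = 1 / sqrt (2 * pi) * sqrt (pi / b) + \<epsilon> + exp (- T\<^sup>2 / 4) / sqrt (2 * pi) * sqrt (pi / (1/4))"
    using gaussian_lborel[OF \<open>b > 0\<close>] gaussian_lborel[of "1/4"]
    by (subst Bochner_Integration.integral_add Bochner_Integration.integrable_add; simp)+
  also have "\<dots> = 1 / sqrt (2 * b) + \<epsilon> + sqrt 2 * exp (- T\<^sup>2 / 4)"
  proof -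
    have "sqrt (pi / (1/4)) = sqrt 2 * sqrt (2 * pi)" by (simp flip: real_sqrt_mult)
    then have "exp (- T\<^sup>2 / 4) / sqrt (2 * pi) * sqrt (pi / (1/4)) = sqrt 2 * exp (- T\<^sup>2 / 4)"
      by simp
    moreover have "1 / sqrt (2 * pi) * sqrt (pi / b) = 1 / sqrt (2 * b)"
      by (simp add: real_sqrt_divide real_sqrt_mult)
    ultimately show ?thesis by linarith
  qed
  finally show ?thesis .
qed

section \<open>Poisson weights: moments, size at the mode, variation to its left\<close>

definition poisson_weight :: "real \<Rightarrow> nat \<Rightarrow> real" where
  "poisson_weight l i = exp (- l) * l ^ i / fact i"

lemma poisson_weight_pos: "l > 0 \<Longrightarrow> poisson_weight l i > 0"
  by (simp add: poisson_weight_def)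

text \<open>This recursion drives the moments, the monotonicity and the comparisons of nearby
  weights below.\<close>

lemma poisson_weight_Suc: "poisson_weight l (Suc i) * real (Suc i) = l * poisson_weight l i"
  by (simp add: poisson_weight_def field_simps del: of_nat_Suc)

lemma poisson_weight_sums: "poisson_weight l sums 1"
  using sums_mult[OF exp_converges[of l], of "exp (- l)"]
  by (simp add: poisson_weight_def[abs_def] mult_exp_exp field_simps)

lemma poisson_mean_sums: "(\<lambda>i. poisson_weight l i * real i) sums l"
proof (rule sums_Suc_imp)
  show "(\<lambda>i. poisson_weight l (Suc i) * real (Suc i)) sums l"
    unfolding poisson_weight_Suc using sums_mult[OF poisson_weight_sums, of l l] by simp
qed simp

lemma poisson_variance_sums: "(\<lambda>i. poisson_weight l i * (real i - l)\<^sup>2) sums l"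
proof -
  have "(\<lambda>i. poisson_weight l i * real i * (real i - 1)) sums (l * l)"
  proof (rule sums_Suc_imp)
    show "(\<lambda>i. poisson_weight l (Suc i) * real (Suc i) * (real (Suc i) - 1)) sums (l * l)"
      unfolding poisson_weight_Suc using sums_mult[OF poisson_mean_sums, of l l] by (simp add: mult.assoc)
  qed simp
  \<comment> \<open>Uses (i - l)^2 = i(i - 1) + (1 - 2l) i + l^2, with the factorial moment l^2 just
    obtained.\<close>
  from sums_add[OF this sums_add[OF sums_mult[OF poisson_mean_sums, of "1 - 2 * l" l] sums_mult[OF poisson_weight_sums, of "l\<^sup>2" l]]]
  show ?thesis by (simp add: algebra_simps power2_eq_square)
qed

lemma poisson_weight_le_1: "l > 0 \<Longrightarrow> poisson_weight l i \<le> 1"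
  using sum_le_suminf[OF sums_summable[OF poisson_weight_sums], of "{i}" l]
    sums_unique[OF poisson_weight_sums, of l] poisson_weight_pos[of l]
  by (auto simp: less_imp_le)

lemma poisson_weight_mono:
  assumes "l > 0" "i \<le> j" "real j \<le> l"
  shows "poisson_weight l i \<le> poisson_weight l j"
  using assms(2,3)
proof (induction j rule: dec_induct)
  case (step j)
  have "poisson_weight l j * real (Suc j) \<le> poisson_weight l j * l"
    using step poisson_weight_pos[OF assms(1), of j] by (intro mult_left_mono) auto
  also have "\<dots> = poisson_weight l (Suc j) * real (Suc j)"
    using poisson_weight_Suc[of l j] by (simp only: mult.commute)
  finally have "poisson_weight l j \<le> poisson_weight l (Suc j)" by simp
  then show ?case using step by simp
qed simp

text \<open>The condition reads \<open>Suc j\<close> so that \<open>j\<close> may be the integer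
  part of \<open>l\<close>; together with \<open>poisson_weight_mono\<close> this locates the
  maximum there.\<close>

lemma poisson_weight_antimono:
  assumes "l > 0" "j \<le> i" "l \<le> real (Suc j)"
  shows "poisson_weight l i \<le> poisson_weight l j"
  using assms(2)
proof (induction i rule: dec_induct)
  case (step i)
  have "poisson_weight l (Suc i) * real (Suc i) = poisson_weight l i * l"
    using poisson_weight_Suc[of l i] by (simp only: mult.commute)
  also have "\<dots> \<le> poisson_weight l i * real (Suc i)"
    using step assms poisson_weight_pos[OF assms(1), of i] by (intro mult_left_mono) auto
  finally have "poisson_weight l (Suc i) \<le> poisson_weight l i" by simp
  then show ?case using step by simp
qed simp

text \<open>By Chebyshev, mass at least $3/4$ sits on at most $4x + 1$ points.\<close>
lemma poisson_mode_lower_bound: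
  assumes "x > 0" "real m \<le> x\<^sup>2" "x\<^sup>2 \<le> real (Suc m)"
  shows "3 / 4 \<le> poisson_weight (x\<^sup>2) m * (4 * x + 1)"
proof -
  let ?l = "x\<^sup>2" and ?p = "poisson_weight (x\<^sup>2)"
  have l: "?l > 0" using assms by simp
  \<comment> \<open>Chebyshev in weighted form: the total is 1 - 1/4, and terms more than two
    standard deviations, that is \<open>2 * x\<close>, from the mean are nonpositive.\<close>
  let ?g = "\<lambda>i. ?p i * (1 - (real i - ?l)\<^sup>2 / (4 * ?l))"
  have "(\<lambda>i. ?p i - 1 / (4 * ?l) * (?p i * (real i - ?l)\<^sup>2)) sums (1 - 1 / (4 * ?l) * ?l)"
    by (intro sums_diff sums_mult poisson_weight_sums poisson_variance_sums)
  then have g: "?g sums (3 / 4)" using l by (simp add: algebra_simps)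
  define a where "a = nat \<lceil>?l - 2 * x\<rceil>"
  define b where "b = nat \<lfloor>?l + 2 * x\<rfloor>"
  have mode: "?p i \<le> ?p m" for i
    using poisson_weight_mono[OF l, of i m] poisson_weight_antimono[OF l, of m i] assms by (cases "i \<le> m") auto
  have out: "?g i \<le> 0" if "i \<notin> {a..b}" for i
  proof -
    have "\<bar>real i - ?l\<bar> \<ge> 2 * x"
      using that assms(1) unfolding a_def b_def by (auto simp: not_le) linarith+
    then have "(2 * x)\<^sup>2 \<le> (real i - ?l)\<^sup>2"
      using assms(1) power_mono[of "2 * x" "\<bar>real i - ?l\<bar>" 2] by simp
    then have "1 - (real i - ?l)\<^sup>2 / (4 * ?l) \<le> 0" using l by (simp add: field_simps)
    then show ?thesis using poisson_weight_pos[OF l, of i] by (simp add: mult_nonneg_nonpos)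
  qed
  have inn: "?g i \<le> ?p m" for i
  proof -
    have "?g i \<le> ?p i * 1" using poisson_weight_pos[OF l, of i] l by (intro mult_left_mono) auto
    then show ?thesis using mode[of i] by simp
  qed
  have card: "real (card {a..b}) \<le> 4 * x + 1"
  proof (cases "a \<le> b")
    case True
    have "real b \<le> ?l + 2 * x" using assms(1) l unfolding b_def by (simp add: of_nat_floor)
    moreover have "?l - 2 * x \<le> real a" unfolding a_def by linarith
    ultimately show ?thesis using True by (simp add: of_nat_diff)
  qed (use assms(1) in simp)
  have "(\<Sum>i<n. ?g i) \<le> ?p m * (4 * x + 1)" for n
  proof -
    have "(\<Sum>i<n. ?g i) \<le> (\<Sum>i<n. if i \<in> {a..b} then ?p m else 0)"
      using inn out by (intro sum_mono) auto
    also have "\<dots> = (\<Sum>i\<in>{..<n} \<inter> {a..b}. ?p m)"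
      by (rule sum.inter_restrict[symmetric]) simp
    also have "\<dots> \<le> (\<Sum>i\<in>{a..b}. ?p m)"
      using poisson_weight_pos[OF l, of m] by (intro sum_mono2) auto
    also have "\<dots> \<le> ?p m * (4 * x + 1)"
      using card poisson_weight_pos[OF l, of m] by (simp add: mult.commute)
    finally show ?thesis .
  qed
  then show ?thesis
    using g unfolding sums_def by (intro LIMSEQ_le_const2) auto
qed

text \<open>The quotient of the two weights is a product of \<open>j - i\<close> factors
  \<open>k / l\<close> with i < k \<le> j, each at least \<open>1 - (l - i) / l\<close>; Bernoulli's
  inequality gives the linear bound.\<close>

lemma poisson_weight_slow:
  assumes "l > 0" "i \<le> j" "real j \<le> l"
  shows "poisson_weight l i \<ge> poisson_weight l j * (1 - real (j - i) * (l - real i) / l)"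
  using assms(2,3)
proof (induction j rule: dec_induct)
  case base
  then show ?case by simp
next
  case (step j)
  define A where "A = real (j - i) * (l - real i) / l"
  define B where "B = (l - real i) / l"
  have nn: "A \<ge> 0" "B \<ge> 0" using step assms by (auto simp: A_def B_def)
  have p: "poisson_weight l (Suc j) > 0" using poisson_weight_pos assms by blast
  have r: "real (Suc j) / l \<ge> 1 - B" using step assms unfolding B_def by (simp add: field_simps)
  have pj: "poisson_weight l j = poisson_weight l (Suc j) * (real (Suc j) / l)"
    using poisson_weight_Suc[of l j] assms by (simp add: field_simps del: of_nat_Suc)
  have step_eq: "1 - real (Suc j - i) * (l - real i) / l = 1 - A - B"
    using step by (simp add: A_def B_def Suc_diff_le add_divide_distrib distrib_right)
  show ?case
  \<comment> \<open>If \<open>1 - A\<close> is negative, the claimed lower bound is nonpositive and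
    positivity of the weight suffices.\<close>
  proof (cases "1 - A \<ge> 0")
    case True
    have "1 - A - B \<le> (1 - B) * (1 - A)" using nn mult_nonneg_nonneg[OF nn] by (simp add: algebra_simps)
    also have "\<dots> \<le> real (Suc j) / l * (1 - A)" using r True by (intro mult_right_mono)
    finally have "poisson_weight l (Suc j) * (1 - A - B) \<le> poisson_weight l (Suc j) * (real (Suc j) / l * (1 - A))"
      using p by (intro mult_left_mono) auto
    also have "\<dots> = poisson_weight l j * (1 - A)" by (simp add: pj)
    also have "\<dots> \<le> poisson_weight l i" using step unfolding A_def by simp
    finally show ?thesis unfolding step_eq .
  next
    case False
    then have "poisson_weight l (Suc j) * (1 - A - B) \<le> 0"
      using p nn by (intro mult_nonneg_nonpos) auto
    then show ?thesis using poisson_weight_pos[OF assms(1), of i] unfolding step_eq by simp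
  qed
qed

text \<open>At distance at least \<open>u\<close> below \<open>l\<close>, a step to the left
  multiplies the weight by at most \<open>1 - u / l\<close>, which is at most
  \<open>exp (- u / l)\<close>.\<close>

lemma poisson_weight_decay:
  assumes "l > 0" "real (j + k) \<le> l - u"
  shows "poisson_weight l j \<le> poisson_weight l (j + k) * exp (- (real k * u) / l)"
  using assms(2)
proof (induction k)
  case (Suc k)
  let ?p = "poisson_weight l"
  have "?p (j + k) = ?p (Suc (j + k)) * (real (Suc (j + k)) / l)"
    using poisson_weight_Suc[of l "j + k"] assms(1) by (simp add: field_simps del: of_nat_Suc)
  also have "real (Suc (j + k)) / l \<le> (l - u) / l"
    using Suc.prems assms(1) by (intro divide_right_mono) auto
  also have "(l - u) / l = 1 + (- u / l)" using assms(1) by (simp add: diff_divide_distrib)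
  also have "\<dots> \<le> exp (- u / l)" by (rule exp_ge_add_one_self)
  finally have "?p (j + k) \<le> ?p (Suc (j + k)) * exp (- u / l)"
    using poisson_weight_pos[OF assms(1), of "Suc (j + k)"] by simp
  then have *: "?p (j + k) * exp (- (real k * u) / l) \<le> ?p (Suc (j + k)) * exp (- u / l) * exp (- (real k * u) / l)"
    by (rule mult_right_mono) simp
  have **: "exp (- u / l) * exp (- (real k * u) / l) = exp (- (real (Suc k) * u) / l)"
    by (simp add: mult_exp_exp add_divide_distrib diff_divide_distrib distrib_right)
  have "?p j \<le> ?p (j + k) * exp (- (real k * u) / l)"
    using Suc by simp
  also note *
  also have "?p (Suc (j + k)) * exp (- u / l) * exp (- (real k * u) / l) = ?p (j + Suc k) * exp (- (real (Suc k) * u) / l)"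
    by (simp only: mult.assoc ** add_Suc_right)
  finally show ?case .
qed simp

section \<open>Bounds for the product of characteristic functions\<close>

text \<open>Factors outside the window \<open>W\<close> are bounded by 1; those inside lie in the
  range of Gaussian decay.\<close>

lemma norm_prod_gaussian_le:
  fixes \<phi> :: "real \<Rightarrow> complex"
  assumes "finite I" "W \<subseteq> I" and \<phi>: "\<And>s. cmod (\<phi> s) \<le> 1" "\<And>s. \<bar>s\<bar> \<le> s0 \<Longrightarrow> cmod (\<phi> s) \<le> exp (- s\<^sup>2 / 4)"
    and W: "\<And>i. i \<in> W \<Longrightarrow> \<bar>t * c i\<bar> \<le> s0"
  shows "cmod (\<Prod>i\<in>I. \<phi> (t * c i)) \<le> exp (- (t\<^sup>2 / 4 * (\<Sum>i\<in>W. (c i)\<^sup>2)))"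
proof -
  have fin: "finite W" using assms finite_subset by blast
  have "cmod (\<Prod>i\<in>I. \<phi> (t * c i)) = (\<Prod>i\<in>W. cmod (\<phi> (t * c i))) * (\<Prod>i\<in>I - W. cmod (\<phi> (t * c i)))"
    unfolding prod_norm[symmetric] using prod.subset_diff[OF assms(2,1)] by (simp add: mult.commute)
  also have "\<dots> \<le> (\<Prod>i\<in>W. cmod (\<phi> (t * c i))) * 1"
    by (intro mult_left_mono prod_nonneg prod_le_1) (use \<phi> in auto)
  also have "\<dots> \<le> (\<Prod>i\<in>W. exp (- (t * c i)\<^sup>2 / 4))"
    using \<phi>(2) W by (simp add: prod_mono)
  also have "\<dots> = exp (\<Sum>i\<in>W. - (t * c i)\<^sup>2 / 4)"
    by (simp only: exp_sum[OF fin])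
  also have "(\<Sum>i\<in>W. - (t * c i)\<^sup>2 / 4) = - (t\<^sup>2 / 4 * (\<Sum>i\<in>W. (c i)\<^sup>2))"
    by (simp add: sum_distrib_left power_mult_distrib sum_negf[symmetric])
  finally show ?thesis .
qed

text \<open>Within half a standard deviation left of the mode the weights stay above half the
  maximum. The maximum is at least 3/(20x), so about x/2 indices carry mass (x/2) * 3/(40x) =
  3/80.\<close>

lemma poisson_bulk_lower_bound:
  assumes "x \<ge> 2" and m: "real m \<le> x\<^sup>2" "x\<^sup>2 \<le> real (Suc m)"
  shows "3 / 80 \<le> (\<Sum>i\<in>{m - nat \<lfloor>x / 2\<rfloor>..m}. poisson_weight (x\<^sup>2) i)"
proof -
  let ?p = "poisson_weight (x\<^sup>2)"
  define r where "r = nat \<lfloor>x / 2\<rfloor>"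
  have r: "real r \<le> x / 2" "x / 2 \<le> real r + 1" using assms unfolding r_def by linarith+
  have l: "x\<^sup>2 > 0" using assms by simp
  have "x * 2 \<le> x\<^sup>2" unfolding power2_eq_square using assms by (intro mult_left_mono) auto
  then have rm: "r \<le> m" using r m by linarith
  have half: "?p i \<ge> ?p m / 2" if i: "i \<in> {m - r..m}" for i
  proof -
    have "real (m - i) \<le> real r" "real (m - i) = real m - real i" using i by auto
    then have "real (m - i) * (x\<^sup>2 - real i) \<le> (x / 2) * (x / 2 + 1)"
      using i m r by (intro mult_mono) auto
    also have "\<dots> \<le> x\<^sup>2 / 2" using \<open>x * 2 \<le> x\<^sup>2\<close> by (simp add: power2_eq_square field_simps)
    finally have "1 / 2 \<le> 1 - real (m - i) * (x\<^sup>2 - real i) / x\<^sup>2" using l by (simp add: field_simps)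
    then have "?p m * (1 / 2) \<le> ?p m * (1 - real (m - i) * (x\<^sup>2 - real i) / x\<^sup>2)"
      using poisson_weight_pos[OF l, of m] by (intro mult_left_mono) auto
    also have "\<dots> \<le> ?p i" using poisson_weight_slow[OF l, of i m] i m by auto
    finally show ?thesis by simp
  qed
  have "3 / 4 \<le> ?p m * (4 * x + 1)" using assms by (intro poisson_mode_lower_bound) auto
  also have "\<dots> \<le> ?p m * (5 * x)" using assms poisson_weight_pos[OF l, of m] by (intro mult_left_mono) auto
  finally have "3 / 80 \<le> x / 2 * (?p m / 2)" by (simp add: mult_ac)
  also have "\<dots> \<le> (real r + 1) * (?p m / 2)" using r poisson_weight_pos[OF l, of m] by (intro mult_right_mono) auto
  also have "\<dots> = (\<Sum>i\<in>{m - r..m}. ?p m / 2)" using rm by (simp add: of_nat_diff)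
  also have "\<dots> \<le> (\<Sum>i\<in>{m - r..m}. ?p i)" by (intro sum_mono half)
  finally show ?thesis unfolding r_def .
qed

text \<open>For large \<open>t\<close> the window \<open>W\<close> starts where $|t| c_i$, descending to the left of the mode \<open>m\<close>,
  first drops below \<open>s0\<close>; on the next $\sqrt x / 16$ indices it loses at most a factor $\sqrt 2$.\<close>
lemma prod_poisson_scale_bound:
  fixes \<phi> :: "real \<Rightarrow> complex" and c :: "nat \<Rightarrow> real"
  assumes \<phi>: "\<And>s. cmod (\<phi> s) \<le> 1" "\<And>s. \<bar>s\<bar> \<le> s0 \<Longrightarrow> cmod (\<phi> s) \<le> exp (- s\<^sup>2 / 4)" and "s0 > 0"
    and c: "\<And>i. c i \<ge> 0" "\<And>i. (c i)\<^sup>2 = poisson_weight (x\<^sup>2) i"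
    and x: "x \<ge> 1024" "x\<^sup>2 \<le> real n" and t: "\<bar>t\<bar> * exp (- x / 8) \<le> s0"
  shows "cmod (\<Prod>i=1..n. \<phi> (t * c i)) \<le> exp (- (3 / 320) * t\<^sup>2) + exp (- (s0\<^sup>2 / 256) * sqrt x)"
proof -
  let ?p = "poisson_weight (x\<^sup>2)"
  have l: "x\<^sup>2 > 0" using x by simp
  define m where "m = nat \<lfloor>x\<^sup>2\<rfloor>"
  have m: "real m \<le> x\<^sup>2" "x\<^sup>2 < real m + 1" using l unfolding m_def by linarith+
  have mn: "m \<le> n" using m x by linarith
  have cmono: "c i \<le> c j" if "i \<le> j" "j \<le> m" for i j
  proof (rule power2_le_imp_le)
    show "(c i)\<^sup>2 \<le> (c j)\<^sup>2" unfolding c using that m by (intro poisson_weight_mono l) auto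
  qed (rule c)
  \<comment> \<open>The relevant scales are \<open>q\<close>, \<open>x\<close>, \<open>x * q\<close>
    and \<open>x\<^sup>2\<close>; from \<open>x \<ge> 1024\<close> each is at least 32 times the
    previous one, which leaves room for all roundings.\<close>
  define q where "q = sqrt x"
  have q: "q * q = x" "q \<ge> 32" using x real_sqrt_le_mono[of 1024 x] by (auto simp: q_def)
  have qq: "32 * q \<le> x" unfolding q(1)[symmetric] using q by (intro mult_right_mono) auto
  have xq: "32 * x \<le> x * q" using mult_left_mono[OF q(2), of x] x by (simp add: mult.commute)
  have xxq: "32 * (x * q) \<le> x\<^sup>2" using mult_left_mono[OF qq, of x] x by (simp add: power2_eq_square mult_ac)
  show ?thesis
  proof (cases "\<bar>t * c m\<bar> \<le> s0")
    case True
    define r where "r = nat \<lfloor>x / 2\<rfloor>"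
    have "real r \<le> x / 2" using x unfolding r_def by linarith
    \<comment> \<open>The window must avoid index 0, since the product starts at 1.\<close>
    then have "real r + 1 \<le> real m" using m xxq xq q x by linarith
    then have "{m - r..m} \<subseteq> {1..n}" using mn by auto
    moreover have "\<bar>t * c i\<bar> \<le> s0" if "i \<in> {m - r..m}" for i
    proof -
      have "\<bar>t\<bar> * c i \<le> \<bar>t\<bar> * c m" using that cmono by (intro mult_left_mono) auto
      then show ?thesis using True c by (simp add: abs_mult)
    qed
    ultimately have "cmod (\<Prod>i=1..n. \<phi> (t * c i)) \<le> exp (- (t\<^sup>2 / 4 * (\<Sum>i\<in>{m - r..m}. (c i)\<^sup>2)))"
      by (intro norm_prod_gaussian_le \<phi>) auto
    \<comment> \<open>The constant 3/320 is a quarter of the bulk mass 3/80.\<close>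
    also have "\<dots> \<le> exp (- (t\<^sup>2 / 4 * (3 / 80)))"
      using poisson_bulk_lower_bound[of x m] m x unfolding c r_def exp_le_cancel_iff neg_le_iff_le
      by (intro mult_left_mono) auto
    also have "\<dots> = exp (- (3 / 320) * t\<^sup>2)" by simp
    finally show ?thesis by (simp add: add_increasing2)
  next
    case False
    \<comment> \<open>With \<open>k\<close> about x^(3/2), the \<open>k\<close> steps from
      \<open>m - k\<close> down to \<open>m - 2 * k\<close> shrink the weight by exp(-k^2/x^2) \<le>
      exp(-x/4). Hence \<open>c (m - 2 * k)\<close> is at most \<open>exp (- x / 8)\<close>,
      matching the hypothesis on \<open>t\<close>.\<close>
    define k where "k = nat \<lfloor>x * q\<rfloor>"
    define L where "L = nat \<lfloor>q / 16\<rfloor>"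
    have k: "real k \<le> x * q" "x * q / 2 \<le> real k" using x q xq unfolding k_def by linarith+
    have L: "real L \<le> q / 16" "q / 32 \<le> real L" using q unfolding L_def by linarith+
    have kLm: "2 * k + L \<le> m" using k L m xxq xq q x qq by linarith
    have "x\<^sup>2 * x / 4 \<le> (real k)\<^sup>2"
    proof -
      have "(x * q / 2)\<^sup>2 \<le> (real k)\<^sup>2" using k x q by (intro power_mono) auto
      moreover have "(x * q / 2)\<^sup>2 = x\<^sup>2 * (q * q) / 4" by (simp add: power2_eq_square)
      ultimately show ?thesis unfolding q(1) by simp
    qed
    then have kk: "x / 4 \<le> real k * real k / x\<^sup>2"
      using l by (simp add: field_simps power2_eq_square)
    have "(c (m - 2 * k))\<^sup>2 \<le> ?p (m - 2 * k + k) * exp (- (real k * real k) / x\<^sup>2)"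
      unfolding c using kLm m by (intro poisson_weight_decay l) auto
    also have "\<dots> \<le> 1 * exp (- x / 4)"
      using kk poisson_weight_le_1[OF l] by (intro mult_mono) auto
    also have "\<dots> = (exp (- x / 8))\<^sup>2" by (simp add: power2_eq_square mult_exp_exp)
    finally have "c (m - 2 * k) \<le> exp (- x / 8)" by (rule power2_le_imp_le) simp
    then have low: "\<bar>t * c (m - 2 * k)\<bar> \<le> s0"
      using t mult_left_mono[of "c (m - 2 * k)" "exp (- x / 8)" "\<bar>t\<bar>"] c by (simp add: abs_mult)
    \<comment> \<open>A discrete intermediate value argument: \<open>\<bar>t * c i\<bar>\<close> is
      at most \<open>s0\<close> at \<open>m - 2 * k\<close> and exceeds it at
      \<open>m\<close>.\<close>
    have "\<exists>j\<ge>m - 2 * k. j < m \<and> \<bar>t * c j\<bar> \<le> s0 \<and> s0 < \<bar>t * c (Suc j)\<bar>"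
    proof (rule ccontr)
      assume neg: "\<not> ?thesis"
      have "\<bar>t * c m\<bar> \<le> s0"
      proof (rule nat_induct_at_least[of "m - 2 * k" m "\<lambda>j. j \<le> m \<longrightarrow> \<bar>t * c j\<bar> \<le> s0", THEN mp])
        show "Suc j \<le> m \<longrightarrow> \<bar>t * c (Suc j)\<bar> \<le> s0"
          if "m - 2 * k \<le> j" "j \<le> m \<longrightarrow> \<bar>t * c j\<bar> \<le> s0" for j
          using neg that by force
      qed (use low in auto)
      then show False using False by simp
    qed
    then obtain j where j: "m - 2 * k \<le> j" "j < m" "\<bar>t * c j\<bar> \<le> s0" "s0 < \<bar>t * c (Suc j)\<bar>" by blast
    have top: "s0\<^sup>2 \<le> t\<^sup>2 * ?p (Suc j)"
      using power_mono[of s0 "\<bar>t * c (Suc j)\<bar>" 2] j(4) \<open>s0 > 0\<close> c(2)[of "Suc j"] by (simp add: power_mult_distrib)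
    \<comment> \<open>The window ends at \<open>j\<close>, so monotonicity keeps it below
      \<open>s0\<close>; its weights are compared from below with \<open>Suc j\<close>, the first
      index above \<open>s0\<close>.\<close>
    define W where "W = {Suc j - L..j}"
    have cardW: "card W = L" unfolding W_def using j kLm by simp
    have Wn: "W \<subseteq> {1..n}" unfolding W_def using j kLm mn by auto
    have Ws: "\<bar>t * c i\<bar> \<le> s0" if "i \<in> W" for i
    proof -
      have "\<bar>t\<bar> * c i \<le> \<bar>t\<bar> * c j" using that j cmono unfolding W_def by (intro mult_left_mono) auto
      then show ?thesis using j(3) c by (simp add: abs_mult)
    qed
    have half: "s0\<^sup>2 / 2 \<le> t\<^sup>2 * (c i)\<^sup>2" if i: "i \<in> W" for i
    proof -
      have i': "i \<le> Suc j" "Suc j \<le> i + L" "real m \<le> real i + 2 * real k + real L - 1"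
        using i j kLm unfolding W_def by auto
      \<comment> \<open>This fixes the length \<open>L\<close>: the window may lie about 2x^(3/2)
        below the mean, so a length of order sqrt x keeps length times distance below
        \<open>x\<^sup>2 / 2\<close>.\<close>
      have "real (Suc j - i) * (x\<^sup>2 - real i) \<le> (q / 16) * (2 * (x * q) + q / 16)"
        using i' m k L j by (intro mult_mono) auto
      also have "\<dots> = (q * q) * x / 8 + q * q / 256" by (simp add: algebra_simps)
      also have "\<dots> \<le> x\<^sup>2 / 2" unfolding q(1) using xxq xq x power2_eq_square[of x] by linarith
      finally have "1 / 2 \<le> 1 - real (Suc j - i) * (x\<^sup>2 - real i) / x\<^sup>2" using l by (simp add: field_simps)
      then have "?p (Suc j) * (1 / 2) \<le> ?p (Suc j) * (1 - real (Suc j - i) * (x\<^sup>2 - real i) / x\<^sup>2)"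
        using poisson_weight_pos[OF l, of "Suc j"] by (intro mult_left_mono) auto
      also have "\<dots> \<le> ?p i" using i' j m by (intro poisson_weight_slow l) auto
      finally have "t\<^sup>2 * (?p (Suc j) / 2) \<le> t\<^sup>2 * ?p i" by (intro mult_left_mono) auto
      then show ?thesis using top unfolding c by simp
    qed
    have "real L * (s0\<^sup>2 / 2) = (\<Sum>i\<in>W. s0\<^sup>2 / 2)" by (simp add: cardW)
    also have "\<dots> \<le> (\<Sum>i\<in>W. t\<^sup>2 * (c i)\<^sup>2)" by (intro sum_mono half)
    finally have "real L * (s0\<^sup>2 / 2) \<le> t\<^sup>2 * (\<Sum>i\<in>W. (c i)\<^sup>2)" by (simp add: sum_distrib_left)
    moreover have "q / 32 * (s0\<^sup>2 / 2) \<le> real L * (s0\<^sup>2 / 2)" using L by (intro mult_right_mono) auto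
    \<comment> \<open>The constant is (1/4) * (1/32) * (1/2) = 1/256.\<close>
    ultimately have "- (t\<^sup>2 / 4 * (\<Sum>i\<in>W. (c i)\<^sup>2)) \<le> - (s0\<^sup>2 / 256) * sqrt x"
      unfolding q_def by simp
    moreover have "cmod (\<Prod>i=1..n. \<phi> (t * c i)) \<le> exp (- (t\<^sup>2 / 4 * (\<Sum>i\<in>W. (c i)\<^sup>2)))"
      by (rule norm_prod_gaussian_le[OF finite_atLeastAtMost Wn \<phi> Ws])
    ultimately have "cmod (\<Prod>i=1..n. \<phi> (t * c i)) \<le> exp (- (s0\<^sup>2 / 256) * sqrt x)"
      by (meson exp_le_cancel_iff order_trans)
    then show ?thesis by (simp add: add_increasing)
  qed
qed

section \<open>Choice of the threshold and assembly of the small ball bound\<close>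

theorem theorem4p1:
  fixes \<mu> :: "real measure" and C \<epsilon>g a1 a2 :: real
  assumes "prob_space \<mu>" and "sets \<mu> = sets borel"
    and "subgaussian \<mu>"
    and "integrable \<mu> (\<lambda>y. y)" and "(\<integral>y. y \<partial>\<mu>) = 0"
    and "integrable \<mu> (\<lambda>y. y ^ 2)" and "(\<integral>y. y ^ 2 \<partial>\<mu>) = 1"
    and "C > 0" and "0 < \<epsilon>g" and "\<epsilon>g < 1/2" and "0 < a1" and "a1 < a2"
  shows "\<exists>K N0. \<forall>N \<ge> N0. \<forall>(n::nat) (x::real) (a::real).
           N \<le> sqrt (real n) \<longrightarrow> a1 * N \<le> x \<longrightarrow> x \<le> a2 * N \<longrightarrow>
           x \<le> sqrt (real n) - N powr \<epsilon>g \<longrightarrow>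
           measure (PiM {1..n} (\<lambda>_. \<mu>))
             {\<omega> \<in> space (PiM {1..n} (\<lambda>_. \<mu>)). Pn n \<omega> x \<in> ball a (N powr (- C))}
           \<le> K * N powr (- C)"
proof -
  interpret \<mu>: real_distribution \<mu>
    using assms by (simp add: real_distribution_def real_distribution_axioms_def)
  obtain s0 where s0: "s0 > 0" "\<And>t. \<bar>t\<bar> \<le> s0 \<Longrightarrow> cmod (char \<mu> t) \<le> exp (- t\<^sup>2 / 4)"
    using \<mu>.char_gaussian_decay assms by blast
  define \<gamma> where "\<gamma> = s0\<^sup>2 / 256"
  have "\<gamma> > 0" using s0 by (simp add: \<gamma>_def)
  \<comment> \<open>In order after \<open>1 \<le> N\<close>: the size of \<open>x\<close> and the
    frequency range required by \<open>prod_poisson_scale_bound\<close>, then the large-frequency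
    error and the Gaussian tail, both below the radius.\<close>
  have "eventually (\<lambda>N. 1 \<le> N \<and> 1024 \<le> a1 * N \<and> N * N powr C * exp (- (a1 * N) / 8) \<le> s0
      \<and> exp (- \<gamma> * sqrt (a1 * N)) \<le> N powr (- C) \<and> exp (- N\<^sup>2 / 4) \<le> N powr (- C)) at_top"
  proof (intro eventually_conj)
    show "eventually (\<lambda>N. N * N powr C * exp (- (a1 * N) / 8) \<le> s0) at_top"
    proof -
      have "((\<lambda>N. N * N powr C * exp (- (a1 * N) / 8)) \<longlongrightarrow> 0) at_top"
        using \<open>0 < a1\<close> \<open>C > 0\<close> by real_asymp
      from order_tendstoD(2)[OF this \<open>s0 > 0\<close>] show ?thesis by eventually_elim simp
    qed
    show "eventually (\<lambda>N. exp (- \<gamma> * sqrt (a1 * N)) \<le> N powr (- C)) at_top"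
      using \<open>\<gamma> > 0\<close> \<open>0 < a1\<close> \<open>C > 0\<close> by real_asymp
    show "eventually (\<lambda>N. 1024 \<le> a1 * N) at_top" using \<open>0 < a1\<close> by real_asymp
    show "eventually (\<lambda>N::real. exp (- N\<^sup>2 / 4) \<le> N powr (- C)) at_top" using \<open>C > 0\<close> by real_asymp
  qed (rule eventually_ge_at_top)
  then obtain N0 where N0: "\<And>N. N \<ge> N0 \<Longrightarrow> 1 \<le> N \<and> 1024 \<le> a1 * N \<and> N * N powr C * exp (- (a1 * N) / 8) \<le> s0
      \<and> exp (- \<gamma> * sqrt (a1 * N)) \<le> N powr (- C) \<and> exp (- N\<^sup>2 / 4) \<le> N powr (- C)"
    by (auto simp: eventually_at_top_linorder)
  define K where "K = exp (1/2) * (1 / sqrt (3 / 160) + 1 + sqrt 2)"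
  show ?thesis
  proof (rule exI[of _ K], rule exI[of _ N0], intro allI impI)
    fix N :: real and n :: nat and x a :: real
    assume N: "N0 \<le> N" and x: "a1 * N \<le> x" "x \<le> sqrt (real n) - N powr \<epsilon>g"
    note N0 = N0[OF N]
    have x1: "x \<ge> 1024" using N0 x by linarith
    have "x \<le> sqrt (real n)" using x powr_ge_zero[of N \<epsilon>g] by linarith
    then have "x\<^sup>2 \<le> (sqrt (real n))\<^sup>2" using x1 by (intro power_mono) auto
    then have xn: "x\<^sup>2 \<le> real n" by simp
    let ?d = "N powr (- C)"
    have d: "?d > 0" using N0 by simp
    define c where "c i = exp (- (x ^ 2) / 2) * x ^ i / sqrt (fact i)" for i
    have c: "c i \<ge> 0" "(c i)\<^sup>2 = poisson_weight (x\<^sup>2) i" for i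
    proof -
      show "c i \<ge> 0" using x1 by (simp add: c_def)
      have "(exp (- (x ^ 2) / 2))\<^sup>2 = exp (- x\<^sup>2)" by (simp add: power2_eq_square mult_exp_exp)
      then show "(c i)\<^sup>2 = poisson_weight (x\<^sup>2) i"
        by (simp add: c_def poisson_weight_def power_divide power_mult_distrib power_mult[symmetric] mult.commute)
    qed
    define \<Omega> where "\<Omega> = PiM {1..n} (\<lambda>_. \<mu>)"
    have meas[measurable]: "(\<lambda>\<omega>. \<Sum>i=1..n. c i * \<omega> i) \<in> borel_measurable \<Omega>"
      unfolding \<Omega>_def
      by (intro borel_measurable_sum borel_measurable_times borel_measurable_const measurable_compose[OF measurable_component_singleton])
         auto
    interpret \<Omega>: prob_space \<Omega> unfolding \<Omega>_def by (intro prob_space_PiM assms(1))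
    define D where "D = distr \<Omega> borel (\<lambda>\<omega>. \<Sum>i=1..n. c i * \<omega> i)"
    interpret D: real_distribution D unfolding D_def by (rule \<Omega>.real_distribution_distr) measurable
    have chD: "char D t = (\<Prod>i=1..n. char \<mu> (t * c i))" for t
      unfolding D_def \<Omega>_def by (intro char_PiM_linear_combination \<mu>.real_distribution_axioms finite_atLeastAtMost)
    have Pn: "Pn n \<omega> x = (\<Sum>i=1..n. c i * \<omega> i)" for \<omega>
      by (simp add: Pn_def c_def sum_distrib_left mult_ac)
    \<comment> \<open>Applied with T = \<open>N\<close>, so that the frequencies
      \<open>z / ?d\<close> reach N^(C+1). Scaling \<open>3 / 320\<close> by
      \<open>1 / ?d\<^sup>2\<close> makes the main term proportional to \<open>?d\<close>.\<close>
    have "(LINT z|std_normal_distribution. cmod (char D (z / ?d)))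
        \<le> 1 / sqrt (2 * (3 / 320 / ?d\<^sup>2)) + ?d + sqrt 2 * exp (- N\<^sup>2 / 4)"
    proof (rule std_normal_integral_le)
      fix z :: real assume z: "\<bar>z\<bar> \<le> N"
      have "\<bar>z / ?d\<bar> * exp (- x / 8) \<le> N * N powr C * exp (- (a1 * N) / 8)"
        using z x N0 by (intro mult_mono) (auto simp: powr_minus field_simps abs_mult mult_right_mono)
      then have t: "\<bar>z / ?d\<bar> * exp (- x / 8) \<le> s0" using N0 by linarith
      have "cmod (char D (z / ?d)) \<le> exp (- (3 / 320) * (z / ?d)\<^sup>2) + exp (- (s0\<^sup>2 / 256) * sqrt x)"
        unfolding chD by (intro prod_poisson_scale_bound[OF \<mu>.cmod_char_le_1 s0(2,1) c x1 xn t])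
      also have "exp (- (s0\<^sup>2 / 256) * sqrt x) \<le> exp (- \<gamma> * sqrt (a1 * N))"
        using x \<open>\<gamma> > 0\<close> unfolding \<gamma>_def[symmetric] by simp
      also have "\<dots> \<le> ?d" using N0 by blast
      finally show "cmod (char D (z / ?d)) \<le> exp (- (3 / 320 / ?d\<^sup>2) * z\<^sup>2) + ?d"
        by (simp add: power_divide)
    next
      show "(\<lambda>z. cmod (char D (z / ?d))) \<in> borel_measurable borel" by measurable
    qed (use D.cmod_char_le_1 d N0 in auto)
    also have "1 / sqrt (2 * (3 / 320 / ?d\<^sup>2)) = ?d * (1 / sqrt (3 / 160))"
      using d by (simp add: real_sqrt_divide real_sqrt_mult)
    also have "\<dots> + ?d + sqrt 2 * exp (- N\<^sup>2 / 4) \<le> ?d * (1 / sqrt (3 / 160)) + ?d + sqrt 2 * ?d"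
      using N0 by (intro add_mono mult_left_mono) auto
    also have "\<dots> = (1 / sqrt (3 / 160) + 1 + sqrt 2) * ?d" by (simp add: algebra_simps)
    finally have int: "(LINT z|std_normal_distribution. cmod (char D (z / ?d))) \<le> (1 / sqrt (3 / 160) + 1 + sqrt 2) * ?d" .
    have "measure \<Omega> {\<omega> \<in> space \<Omega>. Pn n \<omega> x \<in> ball a ?d} = measure D (ball a ?d)"
      unfolding D_def Pn by (subst measure_distr[OF meas]) (auto intro!: arg_cong[where f="measure \<Omega>"])
    also have "\<dots> \<le> exp (1/2) * (LINT z|std_normal_distribution. cmod (char D (z / ?d)))"
      by (rule D.small_ball_char[OF d])
    also have "\<dots> \<le> K * ?d"
      unfolding K_def mult.assoc by (intro mult_left_mono int) simp
    finally show "measure (PiM {1..n} (\<lambda>_. \<mu>))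
        {\<omega> \<in> space (PiM {1..n} (\<lambda>_. \<mu>)). Pn n \<omega> x \<in> ball a ?d} \<le> K * ?d"
      unfolding \<Omega>_def .
  qed
qed

end
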